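(* Let $R$ be a field of characteristic $0$ and let $J\in R\langle\langle X,Y\rangle\rangle$ be a group-like element, written as $J=\sum_{\mathbf{k}\in\mathbb{N}_0^{(\infty)}}c_{\mathbf{k}}w_{\mathbf{k}}$ with $c_{\mathbf{k}}\in R$, and let $c_X:=c_{(;1)}$ be the coefficient of $X$ in $J$. Then for every $(k_1,\dots,k_d;k_\infty)\in\mathbb{N}_0^{(\infty)}$, $$c_{(k_1,\dots,k_d;k_\infty)}=\sum_{\substack{s,t\ge0\\ s+t=k_\infty}}(-1)^s\frac{(c_X)^t}{t!}\sum_{\substack{s_1,\dots,s_d\ge0\\ s_1+\cdots+s_d=s}}\binom{k_1+s_1}{k_1}\cdots\binom{k_d+s_d}{k_d}\,c_{(k_1+s_1,\dots,k_d+s_d;0)}.$$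
   Context: $R\langle\langle X,Y\rangle\rangle$ is the ring of non-commutative formal power series in $X,Y$ over $R$. $\mathbb{N}_0^{(\infty)}$ is the set of tuples $\mathbf{k}=(k_1,\dots,k_d;k_\infty)$, $d\ge0$, of non-negative integers, and $w_{\mathbf{k}}=X^{k_1}Y\cdots X^{k_d}YX^{k_\infty}$ (these run over all words in $X,Y$, including $1$). Let $\Delta$ be the continuous algebra homomorphism $R\langle\langle X,Y\rangle\rangle\to R\langle\langle X,Y\rangle\rangle\hat\otimes R\langle\langle X,Y\rangle\rangle$ with $\Delta(X)=X\otimes1+1\otimes X$, $\Delta(Y)=Y\otimes1+1\otimes Y$. An element $J$ is group-like if its constant term is $1$ and $\Delta(J)=J\otimes J$. *)

theory Defs
  imports Complex_Main "HOL-Analysis.Infinite_Sum"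
begin

section \<open>Formal series over a monoid with finite factorizations\<close>

text \<open>
  The ring of non-commutative power series in X, Y and its completed tensor square are both
  convolution rings of all functions on a monoid in which every element has finitely many
  factorizations: the free monoid of words, respectively pairs of words.
\<close>

class fact_monoid =
  fixes mone :: 'a
    and mmul :: "'a \<Rightarrow> 'a \<Rightarrow> 'a"
  assumes mmul_assoc: "mmul (mmul a b) c = mmul a (mmul b c)"
    and mone_left [simp]: "mmul mone a = a"
    and mone_right [simp]: "mmul a mone = a"
    and finite_factorizations: "finite {(a, b). mmul a b = c}"

instantiation list :: (type) fact_monoid
begin

definition mone_list :: "'a list" where "mone_list = []"
definition mmul_list :: "'a list \<Rightarrow> 'a list \<Rightarrow> 'a list" where "mmul_list = (@)"

instance
proof
  fix c :: "'a list"
  have "{(a, b). mmul a b = c} \<subseteq> (\<lambda>i. (take i c, drop i c)) ` {..length c}"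
  proof
    fix p assume "p \<in> {(a, b). mmul a b = c}"
    then show "p \<in> (\<lambda>i. (take i c, drop i c)) ` {..length c}"
      by (intro image_eqI[of _ _ "length (fst p)"]) (auto simp: mmul_list_def)
  qed
  then show "finite {(a, b). mmul a b = c}"
    using finite_subset by blast
qed (auto simp: mone_list_def mmul_list_def)

end

instantiation prod :: (fact_monoid, fact_monoid) fact_monoid
begin

definition mone_prod :: "'a \<times> 'b" where "mone_prod = (mone, mone)"
definition mmul_prod :: "'a \<times> 'b \<Rightarrow> 'a \<times> 'b \<Rightarrow> 'a \<times> 'b"
  where "mmul_prod p q = (mmul (fst p) (fst q), mmul (snd p) (snd q))"

instance
proof
  fix c :: "'a \<times> 'b"
  have "{(p, q). mmul p q = c} \<subseteq>
      (\<lambda>((a, b), (a', b')). ((a, a'), (b, b'))) `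
        ({(a, b). mmul a b = fst c} \<times> {(a, b). mmul a b = snd c})"
    by (force simp: mmul_prod_def)
  moreover have "finite \<dots>"
    by (intro finite_imageI finite_cartesian_product finite_factorizations)
  ultimately show "finite {(p, q). mmul p q = c}"
    using finite_subset by blast
qed (auto simp: mone_prod_def mmul_prod_def mmul_assoc)

end

typedef ('m, 'a) series = "UNIV :: ('m \<Rightarrow> 'a) set"
  morphisms scoeff Series by simp

lemma scoeff_Series [simp]: "scoeff (Series f) = f"
  by (simp add: Series_inverse)

lemma series_eqI: "(\<And>m. scoeff f m = scoeff g m) \<Longrightarrow> f = g"
  by (simp add: scoeff_inject[symmetric] ext)

definition smonom :: "'m \<Rightarrow> ('m, 'a::zero_neq_one) series"
  where "smonom m = Series (\<lambda>n. if n = m then 1 else 0)"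

definition sscale :: "'a::times \<Rightarrow> ('m, 'a) series \<Rightarrow> ('m, 'a) series"
  where "sscale c f = Series (\<lambda>m. c * scoeff f m)"

instantiation series :: (fact_monoid, comm_ring_1) ring_1
begin

definition "0 = Series (\<lambda>_. 0)"
definition "1 = Series (\<lambda>m. if m = mone then 1 else 0)"
definition "f + g = Series (\<lambda>m. scoeff f m + scoeff g m)"
definition "f - g = Series (\<lambda>m. scoeff f m - scoeff g m)"
definition "- f = Series (\<lambda>m. - scoeff f m)"
definition "f * g = Series (\<lambda>m. \<Sum>(a, b) \<in> {(a, b). mmul a b = m}. scoeff f a * scoeff g b)"

instance
proof
  fix f g h :: "('a, 'b) series"
  show "f * g * h = f * (g * h)"
  proof (rule series_eqI)
    fix m :: 'a
    let ?F = "\<lambda>m::'a. {(a, b). mmul a b = m}"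
    have "scoeff (f * g * h) m =
        (\<Sum>p\<in>?F m. \<Sum>q\<in>?F (fst p). scoeff f (fst q) * scoeff g (snd q) * scoeff h (snd p))"
      by (simp add: times_series_def sum_distrib_right case_prod_beta)
    also have "\<dots> = (\<Sum>(p, q)\<in>Sigma (?F m) (\<lambda>p. ?F (fst p)).
        scoeff f (fst q) * scoeff g (snd q) * scoeff h (snd p))"
      by (intro sum.Sigma ballI finite_factorizations)
    also have "\<dots> = (\<Sum>(p, q)\<in>Sigma (?F m) (\<lambda>p. ?F (snd p)).
        scoeff f (fst p) * (scoeff g (fst q) * scoeff h (snd q)))"
      by (rule sum.reindex_bij_witness[where
            i = "\<lambda>((a, _), (b, c)). ((mmul a b, c), (a, b))" and
            j = "\<lambda>((_, c), (a, b)). ((a, mmul b c), (b, c))"])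
        (auto simp: mmul_assoc mult.assoc)
    also have "\<dots> = (\<Sum>p\<in>?F m. \<Sum>q\<in>?F (snd p).
        scoeff f (fst p) * (scoeff g (fst q) * scoeff h (snd q)))"
      by (intro sum.Sigma[symmetric] ballI finite_factorizations)
    also have "\<dots> = scoeff (f * (g * h)) m"
      by (simp add: times_series_def sum_distrib_left case_prod_beta)
    finally show "scoeff (f * g * h) m = scoeff (f * (g * h)) m" .
  qed
  show "1 * f = f"
  proof (rule series_eqI)
    fix m :: 'a
    have "scoeff (1 * f) m = (\<Sum>p\<in>{(a, b). mmul a b = m}. if p = (mone, m) then scoeff f m else 0)"
      unfolding times_series_def one_series_def scoeff_Series
      by (intro sum.cong) (auto split: if_splits)
    then show "scoeff (1 * f) m = scoeff f m"
      by (simp add: finite_factorizations)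
  qed
  show "f * 1 = f"
  proof (rule series_eqI)
    fix m :: 'a
    have "scoeff (f * 1) m = (\<Sum>p\<in>{(a, b). mmul a b = m}. if p = (m, mone) then scoeff f m else 0)"
      unfolding times_series_def one_series_def scoeff_Series
      by (intro sum.cong) (auto split: if_splits)
    then show "scoeff (f * 1) m = scoeff f m"
      by (simp add: finite_factorizations)
  qed
  show "(f + g) * h = f * h + g * h" "f * (g + h) = f * g + f * h"
    by (auto simp: times_series_def plus_series_def case_prod_beta algebra_simps sum.distrib)
  have "scoeff (0 :: ('a, 'b) series) mone \<noteq> scoeff 1 mone"
    by (simp add: zero_series_def one_series_def)
  then show "(0 :: ('a, 'b) series) \<noteq> 1"
    by metis
qed (auto simp: zero_series_def plus_series_def minus_series_def uminus_series_def scoeff_inverse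
    algebra_simps)

end

lemma scoeff_simps [simp]:
  "scoeff 0 m = 0" "scoeff (f + g) m = scoeff f m + scoeff g m"
  "scoeff (f - g) m = scoeff f m - scoeff g m" "scoeff (- f) m = - scoeff f m"
  "scoeff (sscale c f) m = c * scoeff f m"
  by (simp_all add: zero_series_def plus_series_def minus_series_def uminus_series_def sscale_def)

lemma scoeff_one: "scoeff 1 m = (if m = mone then 1 else 0)"
  by (simp add: one_series_def)

lemma scoeff_smonom: "scoeff (smonom n) m = (if m = n then 1 else 0)"
  by (simp add: smonom_def)

lemma scoeff_mult:
  "scoeff (f * g) m = (\<Sum>(a, b) \<in> {(a, b). mmul a b = m}. scoeff f a * scoeff g b)"
  by (simp add: times_series_def)

lemma scoeff_sum: "scoeff (\<Sum>i\<in>I. f i) m = (\<Sum>i\<in>I. scoeff (f i) m)"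
  by (induction I rule: infinite_finite_induct) auto

lemma smonom_mone: "smonom mone = 1"
  by (rule series_eqI) (simp add: scoeff_smonom scoeff_one)

lemma smonom_mult: "smonom a * smonom b = smonom (mmul a b)"
proof (rule series_eqI)
  fix m
  have "scoeff (smonom a * smonom b) m =
      (\<Sum>p\<in>{(x, y). mmul x y = m}. if p = (a, b) then 1 else 0)"
    unfolding scoeff_mult by (intro sum.cong) (auto simp: scoeff_smonom split: if_splits)
  then show "scoeff (smonom a * smonom b) m = scoeff (smonom (mmul a b)) m"
    by (auto simp: finite_factorizations scoeff_smonom)
qed

text \<open>
  The topology of coefficientwise convergence: the product topology for the discrete coefficient
  ring.  For words and pairs of words this is the adic topology, since there are only finitely
  many words of each length.
\<close>

instantiation series :: (type, type) topological_space
begin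

definition open_series :: "('a, 'b) series set \<Rightarrow> bool" where
  "open_series U \<longleftrightarrow>
     (\<forall>f\<in>U. \<exists>F. finite F \<and> (\<forall>g. (\<forall>m\<in>F. scoeff g m = scoeff f m) \<longrightarrow> g \<in> U))"

instance
proof
  show "open (UNIV :: ('a, 'b) series set)"
    by (auto simp: open_series_def)
  fix S T :: "('a, 'b) series set"
  assume S: "open S" and T: "open T"
  show "open (S \<inter> T)"
    unfolding open_series_def
  proof
    fix f assume "f \<in> S \<inter> T"
    then have "f \<in> S" "f \<in> T" by auto
    obtain F where "finite F" "\<forall>g. (\<forall>m\<in>F. scoeff g m = scoeff f m) \<longrightarrow> g \<in> S"
      using bspec[OF S[unfolded open_series_def] \<open>f \<in> S\<close>] by auto
    moreover obtain G where "finite G" "\<forall>g. (\<forall>m\<in>G. scoeff g m = scoeff f m) \<longrightarrow> g \<in> T"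
      using bspec[OF T[unfolded open_series_def] \<open>f \<in> T\<close>] by auto
    ultimately show "\<exists>F. finite F \<and> (\<forall>g. (\<forall>m\<in>F. scoeff g m = scoeff f m) \<longrightarrow> g \<in> S \<inter> T)"
      by (intro exI[of _ "F \<union> G"]) auto
  qed
next
  fix K :: "('a, 'b) series set set"
  assume "\<forall>S\<in>K. open S"
  then show "open (\<Union>K)"
    unfolding open_series_def
  proof (intro ballI)
    fix f assume K: "\<forall>S\<in>K. \<forall>f\<in>S. \<exists>F. finite F \<and> (\<forall>g. (\<forall>m\<in>F. scoeff g m = scoeff f m) \<longrightarrow> g \<in> S)"
      and "f \<in> \<Union>K"
    then obtain S where S: "S \<in> K" "f \<in> S" by blast
    with K obtain F where "finite F" "\<forall>g. (\<forall>m\<in>F. scoeff g m = scoeff f m) \<longrightarrow> g \<in> S"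
      by metis
    with S show "\<exists>F. finite F \<and> (\<forall>g. (\<forall>m\<in>F. scoeff g m = scoeff f m) \<longrightarrow> g \<in> \<Union>K)"
      by (intro exI[of _ F]) auto
  qed
qed

end

lemma open_seriesD:
  assumes "open U" "f \<in> U"
  obtains F where "finite F" "\<And>g. (\<forall>m\<in>F. scoeff g m = scoeff f m) \<Longrightarrow> g \<in> U"
  using bspec[OF assms(1)[unfolded open_series_def] assms(2)] by auto

lemma open_scoeff: "open {g. scoeff g m = c}"
  unfolding open_series_def by (auto intro!: exI[of _ "{m}"])

lemma series_has_sum_monomials:
  fixes f :: "('m::fact_monoid, 'a::comm_ring_1) series"
  shows "((\<lambda>m. sscale (scoeff f m) (smonom m)) has_sum f) UNIV"
  unfolding has_sum_def tendsto_def eventually_finite_subsets_at_top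
proof (intro allI impI)
  fix U :: "('m, 'a) series set"
  assume "open U" "f \<in> U"
  then obtain F where F: "finite F" "\<And>g. (\<forall>m\<in>F. scoeff g m = scoeff f m) \<Longrightarrow> g \<in> U"
    using open_seriesD by blast
  show "\<exists>X. finite X \<and> X \<subseteq> UNIV \<and>
      (\<forall>Y. finite Y \<and> X \<subseteq> Y \<and> Y \<subseteq> UNIV \<longrightarrow> (\<Sum>m\<in>Y. sscale (scoeff f m) (smonom m)) \<in> U)"
  proof (intro exI[of _ F] conjI allI impI ballI F)
    fix Y m assume "finite Y \<and> F \<subseteq> Y \<and> Y \<subseteq> (UNIV :: 'm set)" "m \<in> F"
    then show "scoeff (\<Sum>m\<in>Y. sscale (scoeff f m) (smonom m)) m = scoeff f m"
      by (auto simp: scoeff_sum scoeff_smonom if_distrib sum.delta' cong: if_cong)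
  qed auto
qed


section \<open>Words and non-commutative power series\<close>

datatype letter = LX | LY

type_synonym 'a ncps = "(letter list, 'a) series"

text \<open>The completed tensor square of \<^typ>\<open>'a ncps\<close>, with \<open>u \<otimes> v\<close> represented by the pair \<open>(u, v)\<close>.\<close>

type_synonym 'a ncps2 = "(letter list \<times> letter list, 'a) series"

definition ncX :: "'a::comm_ring_1 ncps" where "ncX = smonom [LX]"
definition ncY :: "'a::comm_ring_1 ncps" where "ncY = smonom [LY]"

definition nc_tensor :: "'a::comm_ring_1 ncps \<Rightarrow> 'a ncps \<Rightarrow> 'a ncps2"
  where "nc_tensor f g = Series (\<lambda>(u, v). scoeff f u * scoeff g v)"

definition w_word :: "nat list \<Rightarrow> nat \<Rightarrow> letter list"
  where "w_word ks kinf = concat (map (\<lambda>k. replicate k LX @ [LY]) ks) @ replicate kinf LX"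

definition nc_coeff :: "'a ncps \<Rightarrow> nat list \<Rightarrow> nat \<Rightarrow> 'a"
  where "nc_coeff J ks kinf = scoeff J (w_word ks kinf)"

definition alg_hom ::
  "(('m::fact_monoid, 'a::comm_ring_1) series \<Rightarrow> ('n::fact_monoid, 'a) series) \<Rightarrow> bool" where
  "alg_hom D \<longleftrightarrow>
     D 1 = 1 \<and> (\<forall>f g. D (f + g) = D f + D g) \<and> (\<forall>f g. D (f * g) = D f * D g) \<and>
     (\<forall>c f. D (sscale c f) = sscale c (D f))"

definition is_comult :: "('a::comm_ring_1 ncps \<Rightarrow> 'a ncps2) \<Rightarrow> bool" where
  "is_comult D \<longleftrightarrow>
     alg_hom D \<and> continuous_on UNIV D \<and>
     D ncX = nc_tensor ncX 1 + nc_tensor 1 ncX \<and>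
     D ncY = nc_tensor ncY 1 + nc_tensor 1 ncY"

text \<open>Well-defined by the lemma \<open>ex1_comult\<close> below.\<close>

definition comult :: "'a::comm_ring_1 ncps \<Rightarrow> 'a ncps2"
  where "comult = (THE D. is_comult D)"

definition group_like :: "'a::comm_ring_1 ncps \<Rightarrow> bool" where
  "group_like J \<longleftrightarrow> scoeff J [] = 1 \<and> comult J = nc_tensor J J"


section \<open>The words \<open>w_k\<close> run over all words\<close>

lemma w_word_Cons: "w_word (k # ks) m = replicate k LX @ LY # w_word ks m"
  by (simp add: w_word_def)

lemma w_word_Nil: "w_word [] m = replicate m LX"
  by (simp add: w_word_def)

lemma replicate_LX_LY_eq:
  "replicate k LX @ LY # u = replicate l LX @ LY # v \<longleftrightarrow> k = l \<and> u = v"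
proof (induction k arbitrary: l)
  case 0
  then show ?case by (cases l) auto
next
  case (Suc k)
  then show ?case by (cases l) auto
qed

lemma LY_in_w_word: "LY \<in> set (w_word ks m) \<longleftrightarrow> ks \<noteq> []"
  by (cases ks) (auto simp: w_word_Cons w_word_Nil)

lemma w_word_inj: "w_word ks m = w_word ls n \<Longrightarrow> ks = ls \<and> m = n"
proof (induction ks arbitrary: ls)
  case Nil
  then have "ls = []"
    by (metis LY_in_w_word)
  with Nil show ?case
    by (auto simp: w_word_Nil)
next
  case (Cons k ks)
  then have "ls \<noteq> []"
    by (metis LY_in_w_word list.distinct(1))
  then obtain l ls' where "ls = l # ls'"
    by (cases ls) auto
  with Cons show ?case
    by (auto simp: w_word_Cons replicate_LX_LY_eq)
qed

lemma w_word_surj: "\<exists>ks m. u = w_word ks m"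
proof (induction u)
  case Nil
  have "[] = w_word [] 0" by (simp add: w_word_Nil)
  then show ?case by blast
next
  case (Cons a u)
  then obtain ks m where u: "u = w_word ks m" by blast
  show ?case
  proof (cases a)
    case LY
    then have "a # u = w_word (0 # ks) m" by (simp add: u w_word_Cons)
    then show ?thesis by blast
  next
    case LX
    show ?thesis
    proof (cases ks)
      case Nil
      then have "a # u = w_word [] (Suc m)" by (simp add: u w_word_Nil LX)
      then show ?thesis by blast
    next
      case (Cons k ks')
      then have "a # u = w_word (Suc k # ks') m" by (simp add: u w_word_Cons LX)
      then show ?thesis by blast
    qed
  qed
qed

lemma bij_w_word: "bij (\<lambda>(ks, m). w_word ks m)"
proof (rule bijI)
  show "inj (\<lambda>(ks, m). w_word ks m)"
    by (rule injI) (auto dest: w_word_inj)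
  show "surj (\<lambda>(ks, m). w_word ks m)"
    unfolding surj_def using w_word_surj by simp
qed

lemma nc_expansion:
  fixes J :: "'a::comm_ring_1 ncps"
  shows "((\<lambda>(ks, m). sscale (nc_coeff J ks m) (smonom (w_word ks m))) has_sum J) UNIV"
  using has_sum_reindex_bij_betw[OF bij_w_word, of "\<lambda>u. sscale (scoeff J u) (smonom u)" J]
    series_has_sum_monomials[of J]
  by (simp add: case_prod_unfold nc_coeff_def)


section \<open>Existence and uniqueness of the comultiplication\<close>

definition letter_comult :: "letter \<Rightarrow> 'a::comm_ring_1 ncps2"
  where "letter_comult a = smonom ([a], []) + smonom ([], [a])"

definition word_comult :: "letter list \<Rightarrow> 'a::comm_ring_1 ncps2"
  where "word_comult u = prod_list (map letter_comult u)"

definition len2 :: "letter list \<times> letter list \<Rightarrow> nat"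
  where "len2 p = length (fst p) + length (snd p)"

definition comult_sum :: "'a::comm_ring_1 ncps \<Rightarrow> 'a ncps2" where
  "comult_sum f =
     Series (\<lambda>p. \<Sum>u | length u = len2 p. scoeff f u * scoeff (word_comult u) p)"

lemma len2_mmul: "len2 (mmul p q) = len2 p + len2 q"
  by (simp add: len2_def mmul_prod_def mmul_list_def)

lemma len2_mone: "len2 mone = 0"
  by (simp add: len2_def mone_prod_def mone_list_def)

lemma UNIV_letter: "(UNIV :: letter set) = {LX, LY}"
  using letter.exhaust by auto

lemma finite_letter: "finite (UNIV :: letter set)"
  by (simp add: UNIV_letter)

lemma finite_words: "finite {u :: letter list. length u = n}"
  using finite_lists_length_eq[of "UNIV :: letter set" n] finite_letter
  by simp

lemma nc_tensor_smonom: "nc_tensor (smonom u) (smonom v) = smonom (u, v)"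
  by (rule series_eqI) (auto simp: nc_tensor_def scoeff_smonom split: if_splits)

lemma letter_comult_tensor:
  "letter_comult LX = nc_tensor ncX 1 + nc_tensor 1 ncX"
  "letter_comult LY = nc_tensor ncY 1 + nc_tensor 1 ncY"
  by (simp_all add: letter_comult_def ncX_def ncY_def nc_tensor_smonom mone_list_def
      flip: smonom_mone)

lemma word_comult_Nil: "word_comult [] = 1"
  by (simp add: word_comult_def)

lemma word_comult_append: "word_comult (u @ v) = word_comult u * word_comult v"
  by (simp add: word_comult_def)

lemma word_comult_degree:
  "len2 p \<noteq> length u \<Longrightarrow> scoeff (word_comult u :: 'a::comm_ring_1 ncps2) p = 0"
proof (induction u arbitrary: p)
  case Nil
  then show ?case
    by (auto simp: word_comult_def scoeff_one len2_mone)
next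
  case (Cons a u)
  have "scoeff (letter_comult a * word_comult u :: 'a ncps2) p = 0"
    unfolding scoeff_mult
  proof (intro sum.neutral ballI)
    fix x assume "x \<in> {(q, r). mmul q r = p}"
    then obtain q r where x: "x = (q, r)" "mmul q r = p" by auto
    show "(case x of (q, r) \<Rightarrow> scoeff (letter_comult a) q * scoeff (word_comult u :: 'a ncps2) r) = 0"
    proof (cases "len2 q = 1")
      case True
      then have "len2 r \<noteq> length u" using Cons.prems x(2) len2_mmul[of q r] by auto
      then show ?thesis using x Cons.IH by simp
    next
      case False
      then have "q \<noteq> ([a], [])" "q \<noteq> ([], [a])" by (auto simp: len2_def)
      then show ?thesis by (simp add: x letter_comult_def scoeff_smonom)
    qed
  qed
  then show ?case by (simp add: word_comult_def)
qed

lemma comult_sum_mult: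
  fixes f g :: "'a::comm_ring_1 ncps"
  shows "comult_sum (f * g) = comult_sum f * comult_sum g"
proof (rule series_eqI)
  fix p :: "letter list \<times> letter list"
  let ?W = "\<lambda>n. {u :: letter list. length u = n}"
  let ?F = "{(q, r). mmul q r = p}"
  let ?T = "\<lambda>u v q r. scoeff f u * scoeff g v * (scoeff (word_comult u) q * scoeff (word_comult v) r)"
  let ?P = "{(u, v). length u + length v = len2 p} :: (letter list \<times> letter list) set"
  have P: "?P = (\<Union>i\<le>len2 p. ?W i \<times> ?W (len2 p - i))" by auto
  have finP: "finite ?P" unfolding P by (intro finite_UN_I finite_cartesian_product finite_words) auto
  have finF: "finite ?F" by (rule finite_factorizations)
  have "scoeff (comult_sum (f * g)) p =
      (\<Sum>w\<in>?W (len2 p). \<Sum>x\<in>{(u, v). u @ v = w}. scoeff f (fst x) * scoeff g (snd x) *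
         scoeff (word_comult w) p)"
    by (simp add: comult_sum_def scoeff_mult sum_distrib_right case_prod_beta mmul_list_def)
  also have "\<dots> = (\<Sum>(w, x)\<in>Sigma (?W (len2 p)) (\<lambda>w. {(u, v). u @ v = w}).
      scoeff f (fst x) * scoeff g (snd x) * scoeff (word_comult w) p)"
    using finite_factorizations[where 'a = "letter list"]
    by (intro sum.Sigma finite_words) (auto simp: mmul_list_def)
  also have "\<dots> = (\<Sum>x\<in>?P. scoeff f (fst x) * scoeff g (snd x) *
      scoeff (word_comult (fst x @ snd x)) p)"
    by (rule sum.reindex_bij_witness[where i = "\<lambda>x. (fst x @ snd x, x)" and j = snd]) auto
  also have "\<dots> = (\<Sum>x\<in>?P. \<Sum>y\<in>?F. ?T (fst x) (snd x) (fst y) (snd y))"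
    by (simp add: word_comult_append scoeff_mult sum_distrib_left case_prod_beta)
  also have "\<dots> = (\<Sum>y\<in>?F. \<Sum>x\<in>?P. ?T (fst x) (snd x) (fst y) (snd y))"
    by (rule sum.swap)
  also have "\<dots> = (\<Sum>y\<in>?F. \<Sum>x\<in>?W (len2 (fst y)) \<times> ?W (len2 (snd y)).
      ?T (fst x) (snd x) (fst y) (snd y))"
  proof (rule sum.cong[OF refl])
    fix y assume "y \<in> ?F"
    then have p: "mmul (fst y) (snd y) = p" by auto
    show "(\<Sum>x\<in>?P. ?T (fst x) (snd x) (fst y) (snd y)) =
        (\<Sum>x\<in>?W (len2 (fst y)) \<times> ?W (len2 (snd y)). ?T (fst x) (snd x) (fst y) (snd y))"
    proof (rule sum.mono_neutral_right[OF finP])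
      show "?W (len2 (fst y)) \<times> ?W (len2 (snd y)) \<subseteq> ?P"
        by (auto simp: len2_mmul simp flip: p)
      show "\<forall>x\<in>?P - ?W (len2 (fst y)) \<times> ?W (len2 (snd y)).
          ?T (fst x) (snd x) (fst y) (snd y) = 0"
      proof
        fix x assume "x \<in> ?P - ?W (len2 (fst y)) \<times> ?W (len2 (snd y))"
        then have "len2 (fst y) \<noteq> length (fst x) \<or> len2 (snd y) \<noteq> length (snd x)"
          by (cases x) auto
        then show "?T (fst x) (snd x) (fst y) (snd y) = 0"
          using word_comult_degree[of "fst y" "fst x", where 'a = 'a]
            word_comult_degree[of "snd y" "snd x", where 'a = 'a] by auto
      qed
    qed
  qed
  also have "\<dots> = (\<Sum>y\<in>?F. scoeff (comult_sum f) (fst y) * scoeff (comult_sum g) (snd y))"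
    by (simp add: comult_sum_def sum_product sum.cartesian_product case_prod_beta mult_ac)
  also have "\<dots> = scoeff (comult_sum f * comult_sum g) p"
    by (simp add: scoeff_mult case_prod_beta)
  finally show "scoeff (comult_sum (f * g)) p = scoeff (comult_sum f * comult_sum g) p" .
qed

lemma comult_sum_smonom: "comult_sum (smonom u) = (word_comult u :: 'a::comm_ring_1 ncps2)"
proof (rule series_eqI)
  fix p
  have "scoeff (comult_sum (smonom u) :: 'a ncps2) p =
      (\<Sum>v | length v = len2 p. if v = u then scoeff (word_comult u) p else 0)"
    unfolding comult_sum_def scoeff_Series by (intro sum.cong) (auto simp: scoeff_smonom split: if_splits)
  then show "scoeff (comult_sum (smonom u)) p = scoeff (word_comult u :: 'a ncps2) p"
    using word_comult_degree[of p u, where 'a = 'a] by (auto simp: finite_words)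
qed

lemma continuous_comult_sum: "continuous_on UNIV (comult_sum :: 'a::comm_ring_1 ncps \<Rightarrow> _)"
  unfolding continuous_on_open_vimage[OF open_UNIV]
proof (intro allI impI)
  fix U :: "'a ncps2 set"
  assume U: "open U"
  show "open (comult_sum -` U \<inter> UNIV)"
    unfolding open_series_def
  proof
    fix f :: "'a ncps" assume "f \<in> comult_sum -` U \<inter> UNIV"
    then obtain F where F: "finite F"
      "\<And>h. (\<forall>p\<in>F. scoeff h p = scoeff (comult_sum f) p) \<Longrightarrow> h \<in> U"
      using open_seriesD[OF U, of "comult_sum f"] by auto
    let ?G = "\<Union>p\<in>F. {u :: letter list. length u = len2 p}"
    show "\<exists>G. finite G \<and>
        (\<forall>g. (\<forall>u\<in>G. scoeff g u = scoeff f u) \<longrightarrow> g \<in> comult_sum -` U \<inter> UNIV)"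
    proof (intro exI[of _ ?G] conjI allI impI)
      show "finite ?G" by (intro finite_UN_I F(1) finite_words)
      fix g assume "\<forall>u\<in>?G. scoeff g u = scoeff f u"
      then have "comult_sum g \<in> U"
        by (intro F(2) ballI) (auto simp: comult_sum_def intro!: sum.cong)
      then show "g \<in> comult_sum -` U \<inter> UNIV" by simp
    qed
  qed
qed

lemma is_comult_comult_sum: "is_comult comult_sum"
  unfolding is_comult_def alg_hom_def
proof (intro conjI allI)
  show "comult_sum 1 = 1"
    using comult_sum_smonom[of "[]"] smonom_mone
    by (metis word_comult_Nil mone_list_def)
  show "comult_sum (f + g) = comult_sum f + comult_sum g" for f g :: "'a ncps"
    by (rule series_eqI) (simp add: comult_sum_def algebra_simps sum.distrib)
  show "comult_sum (sscale c f) = sscale c (comult_sum f)" for c and f :: "'a ncps"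
    by (rule series_eqI) (simp add: comult_sum_def sum_distrib_left mult.assoc)
  show "comult_sum ncX = nc_tensor ncX 1 + nc_tensor 1 ncX"
    "comult_sum ncY = nc_tensor ncY 1 + nc_tensor 1 ncY"
    by (simp_all add: comult_sum_smonom word_comult_def ncX_def ncY_def
        flip: letter_comult_tensor[unfolded ncX_def ncY_def])
qed (rule comult_sum_mult continuous_comult_sum)+

lemma is_comult_unique:
  fixes D :: "'a::comm_ring_1 ncps \<Rightarrow> 'a ncps2"
  assumes D: "is_comult D"
  shows "D = comult_sum"
proof
  fix f :: "'a ncps"
  note C = is_comult_comult_sum[where 'a = 'a]
  have alg: "alg_hom D" "alg_hom (comult_sum :: 'a ncps \<Rightarrow> _)"
    and cont: "continuous_on UNIV D" "continuous_on UNIV (comult_sum :: 'a ncps \<Rightarrow> _)"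
    using D C by (auto simp: is_comult_def)
  have mono: "D (smonom u) = comult_sum (smonom u)" for u
  proof (induction u)
    case Nil
    then show ?case
      using alg smonom_mone[where 'a = "letter list" and 'b = 'a] by (simp add: alg_hom_def mone_list_def)
  next
    case (Cons a u)
    have "D (smonom [a]) = comult_sum (smonom [a])"
      using D C by (cases a) (auto simp: is_comult_def ncX_def ncY_def)
    moreover have "smonom (a # u) = smonom [a] * (smonom u :: 'a ncps)"
      by (simp add: smonom_mult mmul_list_def)
    ultimately show ?case
      using alg Cons by (simp add: alg_hom_def)
  qed
  have zero: "E 0 = 0" if "alg_hom E" for E :: "'a ncps \<Rightarrow> 'a ncps2"
  proof -
    have "E (0 + 0) = E 0 + E 0" using that by (simp only: alg_hom_def)
    then show ?thesis by simp
  qed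
  have fin: "D (\<Sum>u\<in>S. sscale (scoeff f u) (smonom u)) =
      comult_sum (\<Sum>u\<in>S. sscale (scoeff f u) (smonom u))" if "finite S" for S
    using that
  proof (induction S)
    case empty
    then show ?case using zero[OF alg(1)] zero[OF alg(2)] by simp
  next
    case (insert u S)
    then show ?case using alg mono by (simp add: alg_hom_def)
  qed
  show "D f = comult_sum f"
  proof (rule series_eqI)
    fix p
    have nbhd: "\<exists>F. finite F \<and>
        (\<forall>g. (\<forall>u\<in>F. scoeff g u = scoeff f u) \<longrightarrow> scoeff (E g) p = scoeff (E f) p)"
      if E: "continuous_on UNIV E" for E :: "'a ncps \<Rightarrow> 'a ncps2"
    proof -
      have "open (E -` {h. scoeff h p = scoeff (E f) p} \<inter> UNIV)"
        using E open_scoeff[of p "scoeff (E f) p"]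
        unfolding continuous_on_open_vimage[OF open_UNIV] by blast
      moreover have "f \<in> E -` {h. scoeff h p = scoeff (E f) p} \<inter> UNIV" by simp
      ultimately show ?thesis
      proof (rule open_seriesD)
        fix F assume F: "finite F" "\<And>g. (\<forall>u\<in>F. scoeff g u = scoeff f u) \<Longrightarrow>
          g \<in> E -` {h. scoeff h p = scoeff (E f) p} \<inter> UNIV"
        show ?thesis
          using F(1) by (intro exI[of _ F] conjI allI impI) (auto dest!: F(2))
      qed
    qed
    obtain F where F: "finite F \<and>
        (\<forall>g. (\<forall>u\<in>F. scoeff g u = scoeff f u) \<longrightarrow> scoeff (D g) p = scoeff (D f) p)"
      using nbhd[OF cont(1)] ..
    obtain G where G: "finite G \<and>
        (\<forall>g. (\<forall>u\<in>G. scoeff g u = scoeff f u) \<longrightarrow>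
          scoeff (comult_sum g) p = scoeff (comult_sum f) p)"
      using nbhd[OF cont(2)] ..
    let ?g = "\<Sum>u\<in>F \<union> G. sscale (scoeff f u) (smonom u)"
    have g: "scoeff ?g u = scoeff f u" if "u \<in> F \<union> G" for u
      using that F G
      by (auto simp: scoeff_sum scoeff_smonom if_distrib sum.delta' cong: if_cong)
    have "scoeff (D f) p = scoeff (D ?g) p"
      by (rule F[THEN conjunct2, rule_format, symmetric]) (rule g, simp)
    also have "\<dots> = scoeff (comult_sum ?g) p"
      using F G by (subst fin) auto
    also have "\<dots> = scoeff (comult_sum f) p"
      by (rule G[THEN conjunct2, rule_format]) (rule g, simp)
    finally show "scoeff (D f) p = scoeff (comult_sum f) p" .
  qed
qed

lemma ex1_comult: "\<exists>!D :: 'a::comm_ring_1 ncps \<Rightarrow> 'a ncps2. is_comult D"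
  using is_comult_comult_sum is_comult_unique by blast

lemma is_comult_comult: "is_comult comult"
  unfolding comult_def by (rule theI'[OF ex1_comult])

lemma comult_eq_comult_sum: "comult = comult_sum"
  by (rule is_comult_unique[OF is_comult_comult])

end

theory Submission
  imports Defs
begin

text \<open>
  Comparing the coefficients of \<open>X \<otimes> w\<close> in \<open>\<Delta>(J) = J \<otimes> J\<close> shows that \<open>c\<^sub>X c\<^sub>w\<close> is the
  sum of the coefficients of \<open>J\<close> at all words obtained by inserting one \<open>X\<close> into \<open>w\<close>.  For
  \<open>w = w\<^sub>k\<close> this reads
  \<open>(k\<^sub>\<infinity> + 1) c(k; k\<^sub>\<infinity> + 1) = c\<^sub>X c(k; k\<^sub>\<infinity>) - (\<Sum>i. (k\<^sub>i + 1) c(k + e\<^sub>i; k\<^sub>\<infinity>))\<close>,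
  which determines all coefficients from those with \<open>k\<^sub>\<infinity> = 0\<close>.  The right-hand side of the
  theorem satisfies the same recurrence.
\<close>

section \<open>Inserting a letter into a word\<close>

lemma scoeff_smonom_mult:
  "scoeff (smonom a * f) m = (\<Sum>r | mmul a r = m. scoeff f r)"
proof -
  have "scoeff (smonom a * f) m = (\<Sum>p\<in>{(x, y). mmul x y = m} \<inter> {p. fst p = a}. scoeff f (snd p))"
    unfolding scoeff_mult
    by (subst sum.inter_restrict[OF finite_factorizations])
      (auto intro!: sum.cong simp: scoeff_smonom)
  also have "\<dots> = (\<Sum>r | mmul a r = m. scoeff f r)"
    by (rule sum.reindex_bij_witness[where i = "\<lambda>r. (a, r)" and j = snd]) auto
  finally show ?thesis .
qed

text \<open>Left multiplication by \<open>letter_comult b\<close>, that is b \<otimes> 1 + 1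
  \<otimes> b, puts the letter \<open>b\<close> in front of exactly one of the two tensor
  factors.\<close>

lemma word_comult_Cons:
  "scoeff (word_comult (b # v) :: 'a::comm_ring_1 ncps2) (x, u) =
     (if x \<noteq> [] \<and> hd x = b then scoeff (word_comult v) (tl x, u) else 0) +
     (if u \<noteq> [] \<and> hd u = b then scoeff (word_comult v) (x, tl u) else 0)"
proof -
  have "{r. mmul ([b], []) r = (x, u)} = (if x \<noteq> [] \<and> hd x = b then {(tl x, u)} else {})"
    "{r. mmul ([], [b]) r = (x, u)} = (if u \<noteq> [] \<and> hd u = b then {(x, tl u)} else {})"
    by (cases x; cases u; auto simp: mmul_prod_def mmul_list_def)+
  then show ?thesis
    by (simp add: word_comult_def letter_comult_def distrib_right scoeff_smonom_mult)
qed

lemma word_comult_Nil_left: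
  "scoeff (word_comult v :: 'a::comm_ring_1 ncps2) ([], u) = (if u = v then 1 else 0)"
proof (induction v arbitrary: u)
  case Nil
  then show ?case
    by (simp add: word_comult_Nil scoeff_one mone_prod_def mone_list_def)
next
  case (Cons b v)
  then show ?case
    by (cases u) (auto simp: word_comult_Cons)
qed

text \<open>This is the linear extension of \<open>f\<close> applied to the shuffle product of
  \<open>[a]\<close> and \<open>u\<close>: a word arising from several insertion positions is
  counted once for each of them.\<close>

fun insert_sum :: "'b \<Rightarrow> ('b list \<Rightarrow> 'a::comm_ring_1) \<Rightarrow> 'b list \<Rightarrow> 'a" where
  "insert_sum a f [] = f [a]"
| "insert_sum a f (b # u) = f (a # b # u) + insert_sum a (\<lambda>v. f (b # v)) u"

lemma sum_words_Suc:
  "(\<Sum>v :: letter list | length v = Suc n. g v) = (\<Sum>b\<in>UNIV. \<Sum>v | length v = n. g (b # v))"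
proof -
  have "(\<Sum>b\<in>UNIV. \<Sum>v | length v = n. g (b # v)) =
      (\<Sum>(b, v)\<in>UNIV \<times> {v. length v = n}. g (b # v))"
    by (rule sum.cartesian_product)
  also have "\<dots> = (\<Sum>v | length v = Suc n. g v)"
    by (rule sum.reindex_bij_witness[where i = "\<lambda>v. (hd v, tl v)" and j = "\<lambda>(b, v). b # v"])
      (auto simp: length_Suc_conv)
  finally show ?thesis ..
qed

text \<open>The left side is the coefficient at \<open>([a], u)\<close> of the comultiplication of
  the series with coefficients \<open>f\<close>. In the induction \<open>f\<close> varies, since a
  fixed first letter is absorbed into it.\<close>

lemma insert_sum_word_comult:
  fixes f :: "letter list \<Rightarrow> 'a::comm_ring_1"
  shows "(\<Sum>v | length v = Suc (length u). f v * scoeff (word_comult v) ([a], u)) = insert_sum a f u"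
proof (induction u arbitrary: f)
  case Nil
  have "{v :: letter list. length v = 0} = {[]}" by auto
  then have "(\<Sum>v | length v = Suc (length []). f v * scoeff (word_comult v) ([a], [])) =
      (\<Sum>b\<in>UNIV. if b = a then f [a] else 0)"
    unfolding list.size(3) sum_words_Suc
    by (intro sum.cong) (auto simp: word_comult_Cons word_comult_Nil_left)
  then show ?case
    by (simp add: finite_letter)
next
  case (Cons c u)
  have "(\<Sum>v | length v = Suc (length u). f (b # v) * scoeff (word_comult (b # v)) ([a], c # u)) =
      (if b = a then f (a # c # u) else 0) + (if b = c then insert_sum a (\<lambda>v. f (c # v)) u else 0)"
    for b
  proof -
    \<comment> \<open>If the first letter \<open>b\<close> goes to the left factor, nothing remains
      there and \<open>v = c # u\<close> is forced; if it goes to the right factor, then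
      \<open>b = c\<close> and the induction hypothesis takes over.\<close>
    have "(\<Sum>v | length v = Suc (length u). f (b # v) * scoeff (word_comult (b # v)) ([a], c # u)) =
      (\<Sum>v | length v = Suc (length u).
        (if v = c # u then if b = a then f (a # c # u) else 0 else 0) +
        (if b = c then f (c # v) * scoeff (word_comult v) ([a], u) else 0))"
      by (intro sum.cong) (auto simp: word_comult_Cons word_comult_Nil_left algebra_simps)
    then show ?thesis
      using finite_words[of "Suc (length u)"] by (simp add: sum.distrib Cons.IH)
  qed
  then show ?case
    unfolding sum_words_Suc list.size(4) add_Suc_right add_0_right
    by (simp add: sum.distrib finite_letter)
qed

lemma group_like_insert_sum:
  assumes "group_like J"
  shows "scoeff J [a] * scoeff J u = insert_sum a (scoeff J) u"
proof -
  have "scoeff (comult_sum J) ([a], u) = scoeff (nc_tensor J J) ([a], u)"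
    using assms by (simp add: group_like_def comult_eq_comult_sum)
  then show ?thesis
    by (simp add: comult_sum_def nc_tensor_def len2_def insert_sum_word_comult)
qed

lemma insert_sum_replicate:
  "insert_sum a f (replicate m a) = of_nat (Suc m) * f (replicate (Suc m) a)"
  by (induction m arbitrary: f) (simp_all add: algebra_simps)

text \<open>The \<open>Suc k\<close> positions in front of \<open>b\<close> all produce the same
  word; every other insertion takes place behind \<open>b\<close>.\<close>

lemma insert_sum_replicate_append:
  "insert_sum a f (replicate k a @ b # u) =
     of_nat (Suc k) * f (replicate (Suc k) a @ b # u) +
     insert_sum a (\<lambda>v. f (replicate k a @ b # v)) u"
  by (induction k arbitrary: f) (simp_all add: algebra_simps replicate_app_Cons_same)

lemma insert_sum_w_word:
  "insert_sum LX f (w_word ks m) =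
     (\<Sum>i<length ks. of_nat (Suc (ks ! i)) * f (w_word (ks[i := Suc (ks ! i)]) m)) +
     of_nat (Suc m) * f (w_word ks (Suc m))"
proof (induction ks arbitrary: f)
  case Nil
  then show ?case
    by (simp only: w_word_Nil insert_sum_replicate) simp
next
  case (Cons k ks)
  show ?case
    by (simp only: w_word_Cons insert_sum_replicate_append Cons.IH list.size(4) add_Suc_right
        add_0_right sum.lessThan_Suc_shift nth_Cons_0 nth_Cons_Suc list_update_code add.assoc)
qed

lemma nc_coeff_Suc:
  assumes "group_like J"
  shows "of_nat (Suc m) * nc_coeff J ks (Suc m) =
     nc_coeff J [] 1 * nc_coeff J ks m -
     (\<Sum>i<length ks. of_nat (Suc (ks ! i)) * nc_coeff J (ks[i := Suc (ks ! i)]) m)"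
  using group_like_insert_sum[OF assms, of LX "w_word ks m"]
  by (simp add: insert_sum_w_word nc_coeff_def w_word_Nil algebra_simps)

section \<open>The recurrence for the binomial sums\<close>

definition weak_comps :: "nat \<Rightarrow> nat \<Rightarrow> nat list set" where
  "weak_comps n s = {ss. length ss = n \<and> sum_list ss = s}"

lemma finite_weak_comps: "finite (weak_comps n s)"
proof (rule finite_subset)
  show "weak_comps n s \<subseteq> {ss. set ss \<subseteq> {..s} \<and> length ss = n}"
    by (auto simp: weak_comps_def member_le_sum_list)
qed (simp add: finite_lists_length_eq)

lemma weak_comps_0: "weak_comps n 0 = {replicate n 0}"
  by (auto simp: weak_comps_def sum_list_replicate intro!: replicate_eqI)

text \<open>Raising entry \<open>i\<close> maps \<open>weak_comps n s\<close> bijectively onto the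
  members of \<open>weak_comps n (Suc s)\<close> with positive entry \<open>i\<close>; the remaining
  members contribute 0 because of the factor \<open>ss ! i\<close>.\<close>

lemma sum_weak_comps_update:
  fixes h :: "nat \<Rightarrow> nat list \<Rightarrow> 'a::comm_ring_1"
  shows "(\<Sum>i<n. \<Sum>ss\<in>weak_comps n s. of_nat (Suc (ss ! i)) * h i (ss[i := Suc (ss ! i)])) =
    (\<Sum>i<n. \<Sum>ss\<in>weak_comps n (Suc s). of_nat (ss ! i) * h i ss)"
proof (rule sum.cong[OF refl])
  fix i assume "i \<in> {..<n}"
  then have i: "i < n" by simp
  have "(\<Sum>ss\<in>weak_comps n (Suc s). of_nat (ss ! i) * h i ss) =
      (\<Sum>ss\<in>{ss \<in> weak_comps n (Suc s). ss ! i > 0}. of_nat (ss ! i) * h i ss)"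
    by (rule sum.mono_neutral_right[OF finite_weak_comps]) auto
  also have "\<dots> = (\<Sum>ss\<in>weak_comps n s. of_nat (Suc (ss ! i)) * h i (ss[i := Suc (ss ! i)]))"
    using i
    by (intro sum.reindex_bij_witness[where i = "\<lambda>ss. ss[i := Suc (ss ! i)]" and
          j = "\<lambda>ss. ss[i := ss ! i - 1]"])
      (auto simp: weak_comps_def sum_list_update elem_le_sum_list)
  finally show "(\<Sum>ss\<in>weak_comps n s. of_nat (Suc (ss ! i)) * h i (ss[i := Suc (ss ! i)])) =
      (\<Sum>ss\<in>weak_comps n (Suc s). of_nat (ss ! i) * h i ss)" ..
qed

definition binom_sum :: "(nat list \<Rightarrow> 'a::comm_ring_1) \<Rightarrow> nat list \<Rightarrow> nat \<Rightarrow> 'a" where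
  "binom_sum F ks s = (\<Sum>ss\<in>weak_comps (length ks) s.
     (\<Prod>i<length ks. of_nat ((ks ! i + ss ! i) choose (ks ! i))) * F (map2 (+) ks ss))"

text \<open>Only factor \<open>i\<close> changes. With k = \<open>ks ! i\<close> and r =
  \<open>ss ! i\<close>, both (k+1) C(k+1+r, k+1) and (r+1) C(k+1+r, k) equal (k+1+r)! / (k!
  r!).\<close>

lemma prod_binomial_update:
  assumes "length ss = length ks" "i < length ks"
  shows "Suc (ks ! i) * (\<Prod>j<length ks. (ks[i := Suc (ks ! i)] ! j + ss ! j) choose
           (ks[i := Suc (ks ! i)] ! j)) =
         Suc (ss ! i) * (\<Prod>j<length ks. (ks ! j + ss[i := Suc (ss ! i)] ! j) choose (ks ! j))"
proof -
  have *: "(\<Prod>j<length ks. g j) = g i * (\<Prod>j\<in>{..<length ks} - {i}. g j)" for g :: "nat \<Rightarrow> nat"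
    using assms by (simp add: prod.remove)
  have "Suc (ks ! i) * (Suc (ks ! i + ss ! i) choose Suc (ks ! i)) =
      Suc (ss ! i) * (Suc (ks ! i + ss ! i) choose (ks ! i))"
    using Suc_times_binomial_add[of "ks ! i" "ss ! i"] by simp
  then show ?thesis
    using assms by (simp add: * mult.assoc[symmetric] del: mult_Suc binomial_Suc_Suc)
qed

lemma map2_add_update:
  fixes ks ss :: "nat list"
  assumes "length ss = length ks" "i < length ks"
  shows "map2 (+) (ks[i := Suc (ks ! i)]) ss = map2 (+) ks (ss[i := Suc (ss ! i)])"
  using assms by (intro nth_equalityI) (auto simp: nth_list_update)

text \<open>Raising an entry of \<open>ks\<close> is traded for raising the same entry of
  \<open>ss\<close>, which leaves \<open>map2 (+) ks ss\<close> unchanged. After reindexing, the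
  weights \<open>ss ! i\<close> add up to \<open>Suc s\<close>.\<close>

lemma binom_sum_Suc:
  "(\<Sum>i<length ks. of_nat (Suc (ks ! i)) * binom_sum F (ks[i := Suc (ks ! i)]) s) =
     of_nat (Suc s) * binom_sum F ks (Suc s)"
proof -
  let ?n = "length ks"
  let ?h = "\<lambda>ss. (\<Prod>j<?n. of_nat ((ks ! j + ss ! j) choose (ks ! j))) * F (map2 (+) ks ss)"
  have "(\<Sum>i<?n. of_nat (Suc (ks ! i)) * binom_sum F (ks[i := Suc (ks ! i)]) s) =
      (\<Sum>i<?n. \<Sum>ss\<in>weak_comps ?n s. of_nat (Suc (ss ! i)) * ?h (ss[i := Suc (ss ! i)]))"
  proof (rule sum.cong[OF refl])
    fix i assume "i \<in> {..<?n}"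
    then have i: "i < ?n" by simp
    have "of_nat (Suc (ks ! i)) * ((\<Prod>j<?n. of_nat ((ks[i := Suc (ks ! i)] ! j + ss ! j) choose
           (ks[i := Suc (ks ! i)] ! j))) * F (map2 (+) (ks[i := Suc (ks ! i)]) ss)) =
         of_nat (Suc (ss ! i)) * ?h (ss[i := Suc (ss ! i)])" if "ss \<in> weak_comps ?n s" for ss
    proof -
      have l: "length ss = ?n" using that by (simp add: weak_comps_def)
      show ?thesis
        unfolding map2_add_update[OF l i] mult.assoc[symmetric] of_nat_prod[symmetric]
          of_nat_mult[symmetric] prod_binomial_update[OF l i] ..
    qed
    then show "of_nat (Suc (ks ! i)) * binom_sum F (ks[i := Suc (ks ! i)]) s =
        (\<Sum>ss\<in>weak_comps ?n s. of_nat (Suc (ss ! i)) * ?h (ss[i := Suc (ss ! i)]))"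
      unfolding binom_sum_def sum_distrib_left length_list_update by (intro sum.cong refl)
  qed
  also have "\<dots> = (\<Sum>i<?n. \<Sum>ss\<in>weak_comps ?n (Suc s). of_nat (ss ! i) * ?h ss)"
    by (rule sum_weak_comps_update)
  also have "\<dots> = (\<Sum>ss\<in>weak_comps ?n (Suc s). (\<Sum>i<?n. of_nat (ss ! i)) * ?h ss)"
    by (subst sum.swap) (simp only: sum_distrib_right)
  also have "\<dots> = (\<Sum>ss\<in>weak_comps ?n (Suc s). of_nat (Suc s) * ?h ss)"
  proof (rule sum.cong[OF refl])
    fix ss assume "ss \<in> weak_comps ?n (Suc s)"
    then have "(\<Sum>i<?n. ss ! i) = Suc s"
      by (auto simp: weak_comps_def sum_list_sum_nth atLeast0LessThan)
    then show "(\<Sum>i<?n. of_nat (ss ! i)) * ?h ss = of_nat (Suc s) * ?h ss"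
      by (simp only: of_nat_sum[symmetric])
  qed
  also have "\<dots> = of_nat (Suc s) * binom_sum F ks (Suc s)"
    by (simp only: binom_sum_def sum_distrib_left)
  finally show ?thesis .
qed

lemma binom_sum_0: "binom_sum F ks 0 = F ks"
proof -
  have "map2 (+) ks (replicate (length ks) 0) = ks"
    by (intro nth_equalityI) auto
  then show ?thesis
    by (simp add: binom_sum_def weak_comps_0)
qed

text \<open>The right-hand side of the theorem with t = \<open>m - s\<close>, where \<open>x\<close>
  and \<open>F\<close> stand for c_X and the coefficients with last index 0. Its recurrence is thus
  an identity independent of any group-like series.\<close>

definition exp_binom_sum :: "'a::field_char_0 \<Rightarrow> (nat list \<Rightarrow> 'a) \<Rightarrow> nat list \<Rightarrow> nat \<Rightarrow> 'a" where
  "exp_binom_sum x F ks m = (\<Sum>s\<le>m. (-1) ^ s * (x ^ (m - s) / fact (m - s)) * binom_sum F ks s)"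

lemma exp_binom_sum_Suc:
  "of_nat (Suc m) * exp_binom_sum x F ks (Suc m) =
     x * exp_binom_sum x F ks m -
     (\<Sum>i<length ks. of_nat (Suc (ks ! i)) * exp_binom_sum x F (ks[i := Suc (ks ! i)]) m)"
proof -
  let ?e = "\<lambda>t. x ^ t / fact t"
  let ?B = "binom_sum F ks"
  have e: "of_nat (Suc t) * ?e (Suc t) = x * ?e t" for t
    by (simp add: field_simps del: of_nat_Suc)
  \<comment> \<open>Splitting \<open>Suc m\<close> as \<open>(Suc m - s) + s\<close> separates the
    two terms of the recurrence: the first part acts on the power of \<open>x\<close>, the second on
    \<open>binom_sum\<close>.\<close>
  have "of_nat (Suc m) * exp_binom_sum x F ks (Suc m) =
      (\<Sum>s\<le>Suc m. of_nat (Suc m - s) * ((-1) ^ s * ?e (Suc m - s) * ?B s)) +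
      (\<Sum>s\<le>Suc m. of_nat s * ((-1) ^ s * ?e (Suc m - s) * ?B s))"
    unfolding exp_binom_sum_def sum_distrib_left sum.distrib[symmetric] distrib_right[symmetric]
      of_nat_add[symmetric] by (intro sum.cong) auto
  \<comment> \<open>The summand at \<open>s = Suc m\<close> vanishes.\<close>
  also have "(\<Sum>s\<le>Suc m. of_nat (Suc m - s) * ((-1) ^ s * ?e (Suc m - s) * ?B s)) =
      (\<Sum>s\<le>m. (-1) ^ s * (of_nat (Suc (m - s)) * ?e (Suc (m - s))) * ?B s)"
    unfolding sum.atMost_Suc
    by (simp add: Suc_diff_le mult_ac del: of_nat_Suc power_Suc fact_Suc of_nat_diff)
  also have "\<dots> = x * exp_binom_sum x F ks m"
    unfolding e exp_binom_sum_def sum_distrib_left by (intro sum.cong) auto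
  \<comment> \<open>The summand at \<open>s = 0\<close> vanishes; shifting the index produces the
    minus sign.\<close>
  also have "(\<Sum>s\<le>Suc m. of_nat s * ((-1) ^ s * ?e (Suc m - s) * ?B s)) =
      - (\<Sum>s\<le>m. (-1) ^ s * ?e (m - s) * (of_nat (Suc s) * ?B (Suc s)))"
    unfolding sum.atMost_Suc_shift sum_negf[symmetric] by (simp add: algebra_simps del: of_nat_Suc)
  also have "(\<Sum>s\<le>m. (-1) ^ s * ?e (m - s) * (of_nat (Suc s) * ?B (Suc s))) =
      (\<Sum>i<length ks. of_nat (Suc (ks ! i)) * exp_binom_sum x F (ks[i := Suc (ks ! i)]) m)"
    unfolding binom_sum_Suc[symmetric] exp_binom_sum_def sum_distrib_left
    by (subst sum.swap) (intro sum.cong refl, simp only: mult_ac)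
  finally show ?thesis by simp
qed

text \<open>Both sides obey the same recurrence in \<open>m\<close> and agree at
  \<open>m = 0\<close>. The induction needs all \<open>ks\<close> at once, because the recurrence
  raises their entries.\<close>

lemma group_like_nc_coeff:
  assumes "group_like J"
  shows "nc_coeff J ks m = exp_binom_sum (nc_coeff J [] 1) (\<lambda>l. nc_coeff J l 0) ks m"
proof (induction m arbitrary: ks)
  case 0
  show ?case by (simp add: exp_binom_sum_def binom_sum_0)
next
  case (Suc m)
  have "of_nat (Suc m) * nc_coeff J ks (Suc m) =
      of_nat (Suc m) * exp_binom_sum (nc_coeff J [] 1) (\<lambda>l. nc_coeff J l 0) ks (Suc m)"
    unfolding nc_coeff_Suc[OF assms] exp_binom_sum_Suc Suc.IH ..
  \<comment> \<open>Characteristic 0 allows cancelling \<open>of_nat (Suc m)\<close>.\<close>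
  then show ?case
    by (simp del: of_nat_Suc)
qed

theorem theorem4p1:
  fixes J :: "'a::field_char_0 ncps" and ks :: "nat list" and kinf :: nat
  assumes "group_like J"
  shows "nc_coeff J ks kinf =
    (\<Sum>(s, t) \<in> {(s, t). s + t = kinf}.
       (-1) ^ s * (nc_coeff J [] 1 ^ t / fact t) *
       (\<Sum>ss \<in> {ss :: nat list. length ss = length ks \<and> sum_list ss = s}.
          (\<Prod>i<length ks. of_nat ((ks ! i + ss ! i) choose (ks ! i))) *
          nc_coeff J (map2 (+) ks ss) 0))"
proof -
  have "nc_coeff J ks kinf =
      (\<Sum>(s, t) \<in> {(s, t). s + t = kinf}. (-1) ^ s * (nc_coeff J [] 1 ^ t / fact t) *
         binom_sum (\<lambda>l. nc_coeff J l 0) ks s)"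
    unfolding group_like_nc_coeff[OF assms, of ks kinf] exp_binom_sum_def
    by (rule sum.reindex_bij_witness[where i = fst and j = "\<lambda>s. (s, kinf - s)"]) auto
  then show ?thesis
    by (simp only: binom_sum_def weak_comps_def)
qed

end
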